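(* Let $k\ge 1$ and $n\ge 2k-1$ be integers, and let $\mathcal{F}\subseteq 2^{[n]}$ be $[k]$-differencing. Then $|\mathcal{F}|\le\binom{n}{k}$. Moreover, equality holds if and only if $\mathcal{F}=\binom{[n]}{k}$ or $\mathcal{F}=\binom{[n]}{n-k}$.
   Context: For a positive integer $m$, $[m]=\{1,\ldots,m\}$, and $\binom{[m]}{j}$ denotes the family of all $j$-element subsets of $[m]$. A family $\mathcal{F}\subseteq 2^{[n]}$ of subsets of $[n]$ is called $[k]$-differencing if $|A\setminus B|\in\{1,\ldots,k\}$ for every ordered pair of distinct members $A,B\in\mathcal{F}$. *)

theory Defs
  imports Complex_Main "HOL-Library.Ramsey"
begin

definition differencing :: "nat \<Rightarrow> 'a set set \<Rightarrow> bool" where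
  "differencing k F \<longleftrightarrow> (\<forall>A\<in>F. \<forall>B\<in>F. A \<noteq> B \<longrightarrow> card (A - B) \<in> {1..k})"

end

(* Write v_A for the indicator vector of the k-subsets of A. The functional w_B on k-sets that gives
   K the weight (-1)^t / binomial(card B - 1, t), t = card (K \<inter> B), vanishes at v_A whenever
   card A >= card B > k, B is not contained in A and card (A - B) <= k: the value is a finite
   difference of too high an order. Peeling off the members of F in order of increasing size, the
   vectors v_A are linearly independent if all sizes are at least k, whence the bound. Members of
   size s < k are first pushed up to their upper shadow, which is not smaller as n >= 2k - 1.

   In the case of equality the v_A form a basis. Let a > k be the largest size and X = T - {j} with
   T of size a. Peeling expresses v_X through the members A of size a, with explicit coefficients
   whose sign and size depend only on card (X - A). For a point i outside X, a polynomial of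
   degree k - 1 in card (A \<inter> X) isolates the sets A containing i with a prescribed value of
   card (X - A); their number must be zero unless X + i is a member. So the top level is closed
   under swaps and consists of all a-subsets of its union S. If card S < a + k, replacing it by the
   (a-1)-subsets of S would beat the bound; if card S = a + k, no other members fit, and S is the
   whole ground set. *)

theory Submission
  imports Defs
begin

section \<open>Finite differences of binomials, and linear systems\<close>

text \<open>The sum applies the operator f(c) - f(c + 1) p times to the binomial of lower index
  \<open>q\<close>. Each application lowers \<open>q\<close> by one and flips the sign, so that
  nothing is left once \<open>p\<close> exceeds \<open>q\<close>.\<close>

lemma binomial_finite_difference:
  "(\<Sum>u\<le>p. (-1) ^ u * real (p choose u) * real ((c + u) choose q)) =
   (if p \<le> q then (-1) ^ p * real (c choose (q - p)) else 0)"
proof (induction p arbitrary: c)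
  case 0
  show ?case by simp
next
  case (Suc p)
  let ?S = "\<lambda>p c. \<Sum>u\<le>p. (-1) ^ u * real (p choose u) * real ((c + u) choose q)"
  have shift: "?S p c = real (c choose q) +
      (\<Sum>u\<le>p. (-1) ^ Suc u * real (p choose Suc u) * real ((c + Suc u) choose q))"
    using sum.atMost_Suc_shift[of "\<lambda>u. (-1) ^ u * real (p choose u) * real ((c + u) choose q)" p]
    by (simp add: binomial_eq_0)
  have "?S (Suc p) c = real (c choose q) +
      (\<Sum>u\<le>p. (-1) ^ Suc u * real (Suc p choose Suc u) * real ((c + Suc u) choose q))"
    by (simp add: sum.atMost_Suc_shift del: sum.atMost_Suc binomial_Suc_Suc)
  also have "\<dots> = ?S p c - ?S p (Suc c)"
    unfolding shift by (simp add: sum_subtractf sum_negf algebra_simps)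
  finally have "?S (Suc p) c = ?S p c - ?S p (Suc c)" .
  also have "\<dots> = (if Suc p \<le> q then (-1) ^ Suc p * real (c choose (q - Suc p)) else 0)"
  proof (cases "Suc p \<le> q")
    case True
    then have "q - p = Suc (q - Suc p)" by simp
    then show ?thesis using True unfolding Suc.IH by (simp add: algebra_simps)
  next
    case False
    \<comment> \<open>At \<open>p = q\<close> both terms equal the same constant and cancel; for
      \<open>p > q\<close> both are already zero.\<close>
    then show ?thesis unfolding Suc.IH by (cases "p = q") auto
  qed
  finally show ?case .
qed

text \<open>Gaussian elimination, one equation of \<open>E\<close> at a time.\<close>

lemma underdetermined_system:
  fixes M :: "'b \<Rightarrow> 'c \<Rightarrow> real"
  assumes "finite E" "finite G" "card E < card G"
  shows "\<exists>c. (\<exists>A\<in>G. c A \<noteq> 0) \<and> (\<forall>K\<in>E. (\<Sum>A\<in>G. c A * M A K) = 0)"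
  using assms
proof (induction E arbitrary: G M rule: finite_induct)
  case empty
  then obtain A where "A \<in> G" by fastforce
  then show ?case by (intro exI[of _ "\<lambda>_. 1"]) auto
next
  case (insert e E)
  show ?case
  proof (cases "\<forall>A\<in>G. M A e = 0")
    case True
    obtain c where "\<exists>A\<in>G. c A \<noteq> 0" "\<forall>K\<in>E. (\<Sum>A\<in>G. c A * M A K) = 0"
      using insert.IH[of G M] insert.prems insert.hyps by auto
    with True show ?thesis by (intro exI[of _ c]) auto
  next
    case False
    then obtain A0 where A0: "A0 \<in> G" "M A0 e \<noteq> 0" by blast
    \<comment> \<open>Subtracting the right multiple of the pivot row \<open>A0\<close> clears
      column \<open>e\<close>.\<close>
    define N where "N = (\<lambda>A K. M A K - M A e / M A0 e * M A0 K)"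
    have "card E < card (G - {A0})"
      using insert.prems insert.hyps A0 by simp
    then obtain c where c: "\<exists>A\<in>G - {A0}. c A \<noteq> 0" "\<forall>K\<in>E. (\<Sum>A\<in>G - {A0}. c A * N A K) = 0"
      using insert.IH[of "G - {A0}" N] insert.prems by auto
    \<comment> \<open>Back substitution: the coefficient of \<open>A0\<close> is the one that turns
      a relation for \<open>N\<close> into a relation for \<open>M\<close>; equation
      \<open>e\<close> then holds because \<open>N A e = 0\<close>.\<close>
    define d where "d = c(A0 := - (\<Sum>A\<in>G - {A0}. c A * M A e / M A0 e))"
    have split: "(\<Sum>A\<in>G. d A * M A K) = (\<Sum>A\<in>G - {A0}. c A * N A K)" for K
    proof -
      have "(\<Sum>A\<in>G. d A * M A K) = d A0 * M A0 K + (\<Sum>A\<in>G - {A0}. d A * M A K)"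
        using A0 insert.prems by (simp add: sum.remove)
      also have "(\<Sum>A\<in>G - {A0}. d A * M A K) = (\<Sum>A\<in>G - {A0}. c A * M A K)"
        by (rule sum.cong) (auto simp: d_def)
      finally show ?thesis
        by (simp add: d_def N_def sum_distrib_right right_diff_distrib sum_subtractf mult.assoc)
    qed
    have "(\<Sum>A\<in>G. d A * M A K) = 0" if "K \<in> insert e E" for K
      using that A0 c(2) unfolding split by (auto simp: N_def)
    moreover have "\<exists>A\<in>G. d A \<noteq> 0" using c(1) by (auto simp: d_def)
    ultimately show ?thesis by blast
  qed
qed

section \<open>Test functionals and their values\<close>

lemma sum_nsets_card_Int:
  fixes f :: "nat \<Rightarrow> real"
  assumes "finite A"
  shows "(\<Sum>K\<in>nsets A k. f (card (K \<inter> B))) =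
    (\<Sum>t\<le>k. real (card (A \<inter> B) choose t) * real (card (A - B) choose (k - t)) * f t)"
proof -
  have fin: "finite (nsets A k)" using assms by (simp add: finite_imp_finite_nsets)
  have card: "card {K \<in> nsets A k. card (K \<inter> B) = t} =
      (card (A \<inter> B) choose t) * (card (A - B) choose (k - t))" if "t \<le> k" for t
  proof -
    have "bij_betw (\<lambda>(P, Q). P \<union> Q) (nsets (A \<inter> B) t \<times> nsets (A - B) (k - t))
        {K \<in> nsets A k. card (K \<inter> B) = t}"
    proof (rule bij_betw_byWitness[where f' = "\<lambda>K. (K \<inter> B, K - B)"])
      show "(\<lambda>(P, Q). P \<union> Q) ` (nsets (A \<inter> B) t \<times> nsets (A - B) (k - t))
          \<subseteq> {K \<in> nsets A k. card (K \<inter> B) = t}"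
      proof safe
        fix P Q assume P: "P \<in> nsets (A \<inter> B) t" and Q: "Q \<in> nsets (A - B) (k - t)"
        then have "P \<inter> Q = {}" "(P \<union> Q) \<inter> B = P" by (auto simp: nsets_def)
        with P Q that show "P \<union> Q \<in> nsets A k" "card ((P \<union> Q) \<inter> B) = t"
          by (auto simp: nsets_def card_Un_disjoint)
      qed
      show "(\<lambda>K. (K \<inter> B, K - B)) ` {K \<in> nsets A k. card (K \<inter> B) = t}
          \<subseteq> nsets (A \<inter> B) t \<times> nsets (A - B) (k - t)"
        by (auto simp: nsets_def card_Diff_subset_Int)
    qed (auto simp: nsets_def)
    then show ?thesis
      by (simp add: bij_betw_same_card[symmetric] card_cartesian_product)
  qed
  have "(\<Sum>K\<in>nsets A k. f (card (K \<inter> B))) =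
      (\<Sum>t\<le>k. \<Sum>K | K \<in> nsets A k \<and> card (K \<inter> B) = t. f (card (K \<inter> B)))"
    using fin by (intro sum.group[symmetric]) (auto simp: nsets_def intro: card_mono)
  also have "\<dots> = (\<Sum>t\<le>k. real (card {K \<in> nsets A k. card (K \<inter> B) = t}) * f t)"
    by (intro sum.cong) auto
  finally show ?thesis by (simp add: card)
qed

text \<open>The binomial in the denominator makes the value on a set A a finite difference of a
  polynomial of degree card (B - A) - 1. With \<open>card B\<close> in place of
  \<open>card B - 1\<close> the degree would be one higher, and sets A of the same size as B would
  no longer be annihilated.\<close>

definition test_weight :: "'a set \<Rightarrow> 'a set \<Rightarrow> real" where
  "test_weight B K = (-1) ^ card (K \<inter> B) / real ((card B - 1) choose card (K \<inter> B))"

text \<open>Grouping the k-subsets of A by their intersection with B gives the p-th difference, with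
  p = card (A - B), of the binomial of lower index q = card (B - A) - 1. The condition in the
  conclusion is p \<le> q.\<close>

lemma sum_test_weight:
  assumes "finite A" "finite B" "\<not> B \<subseteq> A" "card (A - B) \<le> k" "k < card B"
  shows "(\<Sum>K\<in>nsets A k. test_weight B K) =
    (if card (A - B) < card (B - A)
     then (-1) ^ (k + card (A - B)) * real ((card B - 1 - k) choose (card (B - A) - 1 - card (A - B)))
     else 0) / real ((card B - 1) choose card (A \<inter> B))"
proof -
  define b s p q where "b = card B - 1" and "s = card (A \<inter> B)" and "p = card (A - B)"
    and "q = card (B - A) - 1"
  have "card B = s + card (B - A)"
    using assms by (simp add: s_def card_Diff_subset_Int Int_commute card_mono)
  moreover have "card (B - A) > 0"
    using assms by (simp add: card_gt_0_iff)
  ultimately have b: "b = s + q" and q: "card (B - A) = Suc q"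
    by (simp_all add: b_def q_def)
  have "k \<le> b" "p \<le> k" using assms by (simp_all add: b_def p_def)
  \<comment> \<open>The quotient on the left is a polynomial in \<open>t\<close> of degree
    \<open>q\<close>; the right side shows it as a single binomial up to a constant.\<close>
  have quot: "real (s choose t) / real (b choose t) = real ((b - t) choose q) / real (b choose s)"
    if "t \<le> b" for t
  proof (cases "t \<le> s")
    case True
    have "(b choose s) * (s choose t) = (b choose t) * ((b - t) choose (s - t))"
      using True b by (intro choose_mult) auto
    moreover have "(b - t) choose (s - t) = (b - t) choose q"
      using True b by (subst binomial_symmetric) auto
    ultimately have "real (b choose s) * real (s choose t) = real (b choose t) * real ((b - t) choose q)"
      by (metis of_nat_mult)
    moreover have "b choose s > 0" "b choose t > 0" using that b by auto
    ultimately show ?thesis by (simp add: field_simps)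
  next
    case False
    then show ?thesis using b that by (simp add: binomial_eq_0)
  qed
  have "(\<Sum>K\<in>nsets A k. test_weight B K) =
      (\<Sum>t\<le>k. real (s choose t) * real (p choose (k - t)) * ((-1) ^ t / real (b choose t)))"
    unfolding test_weight_def s_def p_def b_def using assms(1) by (rule sum_nsets_card_Int)
  also have "\<dots> = (\<Sum>t\<le>k. (-1) ^ t * real (p choose (k - t)) * real ((b - t) choose q) / real (b choose s))"
  proof (rule sum.cong)
    fix t assume "t \<in> {..k}"
    then have "t \<le> b" using \<open>k \<le> b\<close> by simp
    have "real (s choose t) * real (p choose (k - t)) * ((-1) ^ t / real (b choose t)) =
        (-1) ^ t * real (p choose (k - t)) * (real (s choose t) / real (b choose t))"
      by simp
    then show "real (s choose t) * real (p choose (k - t)) * ((-1) ^ t / real (b choose t)) =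
        (-1) ^ t * real (p choose (k - t)) * real ((b - t) choose q) / real (b choose s)"
      by (simp add: quot[OF \<open>t \<le> b\<close>])
  qed simp
  also have "\<dots> = (\<Sum>t\<le>k. (-1) ^ t * real (p choose (k - t)) * real ((b - t) choose q)) / real (b choose s)"
    by (simp add: sum_divide_distrib)
  \<comment> \<open>Substituting u = k - t brings the sum into the shape of
    \<open>binomial_finite_difference\<close> with c = b - k.\<close>
  also have "(\<Sum>t\<le>k. (-1) ^ t * real (p choose (k - t)) * real ((b - t) choose q)) =
      (\<Sum>u\<le>k. (-1) ^ (k - u) * real (p choose u) * real ((b - (k - u)) choose q))"
    by (rule sum.reindex_bij_witness[of _ "\<lambda>u. k - u" "\<lambda>t. k - t"]) auto
  also have "\<dots> = (\<Sum>u\<le>k. (-1) ^ k * ((-1) ^ u * real (p choose u) * real ((b - k + u) choose q)))"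
  proof (rule sum.cong)
    fix u assume "u \<in> {..k}"
    then have "b - (k - u) = b - k + u" using \<open>k \<le> b\<close> by simp
    moreover have "(-1::real) ^ (k - u) = (-1) ^ k * (-1) ^ u"
      using \<open>u \<in> {..k}\<close> by (simp add: minus_one_power_iff)
    ultimately show "(-1) ^ (k - u) * real (p choose u) * real ((b - (k - u)) choose q) =
        (-1) ^ k * ((-1) ^ u * real (p choose u) * real ((b - k + u) choose q))" by simp
  qed simp
  also have "\<dots> = (-1) ^ k * (\<Sum>u\<le>k. (-1) ^ u * real (p choose u) * real ((b - k + u) choose q))"
    by (simp add: sum_distrib_left)
  \<comment> \<open>As \<open>p \<le> k\<close>, the range contains all of 0, ..., p, so the
    difference is complete.\<close>
  also have "(\<Sum>u\<le>k. (-1) ^ u * real (p choose u) * real ((b - k + u) choose q)) =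
      (\<Sum>u\<le>p. (-1) ^ u * real (p choose u) * real ((b - k + u) choose q))"
    using \<open>p \<le> k\<close> by (intro sum.mono_neutral_right) (auto simp: binomial_eq_0)
  finally show ?thesis
    unfolding binomial_finite_difference
    using q by (simp add: s_def p_def b_def power_add less_Suc_eq_le)
qed

lemma sum_test_weight_eq_0:
  assumes "finite A" "finite B" "\<not> B \<subseteq> A" "card (A - B) \<le> k" "k < card B" "card B \<le> card A"
  shows "(\<Sum>K\<in>nsets A k. test_weight B K) = 0"
proof -
  have "card (B - A) \<le> card (A - B)"
    using assms by (simp add: card_le_sym_Diff)
  then show ?thesis using assms by (simp add: sum_test_weight)
qed

text \<open>The borderline case p = q, where the difference is a nonzero constant. It serves for a
  set obtained from a largest member by deleting a point.\<close>

lemma sum_test_weight_smaller: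
  assumes "finite A" "finite B" "card (A - B) \<le> k" "k < card B" "card B = Suc (card A)"
  shows "(\<Sum>K\<in>nsets A k. test_weight B K) =
    (-1) ^ (k + card (A - B)) / real (card A choose card (A - B))"
proof -
  have *: "card A = card (A \<inter> B) + card (A - B)" "card B = card (A \<inter> B) + card (B - A)"
    using assms by (simp_all add: card_Int_Diff) (metis Int_commute card_Int_Diff)
  then have "card (B - A) = Suc (card (A - B))" using assms by simp
  moreover have "\<not> B \<subseteq> A" using assms by (metis card_mono Suc_n_not_le_n)
  moreover have "card A choose card (A - B) = card A choose card (A \<inter> B)"
    using * by (subst binomial_symmetric) auto
  ultimately show ?thesis using assms by (simp add: sum_test_weight)
qed

text \<open>All k-subsets of B get the same weight. That this diagonal value is nonzero is what
  allows a coefficient to be isolated.\<close>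

lemma sum_test_weight_self:
  assumes "finite B" "k < card B"
  shows "(\<Sum>K\<in>nsets B k. test_weight B K) = (-1) ^ k * real (card B) / (real (card B) - real k)"
proof -
  have "(\<Sum>K\<in>nsets B k. test_weight B K) =
      (\<Sum>K\<in>nsets B k. (-1) ^ k / real ((card B - 1) choose k))"
    by (rule sum.cong) (auto simp: test_weight_def nsets_def Int_absorb2)
  also have "\<dots> = (-1) ^ k * real (card B choose k) / real ((card B - 1) choose k)"
    by (simp add: card_nsets)
  also have "real (card B choose k) = real (card B) / (real (card B) - real k) * real ((card B - 1) choose k)"
  proof -
    have "real ((card B - k) * (card B choose k)) = real (card B * ((card B - 1) choose k))"
      by (simp only: binomial_absorb_comp)
    then show ?thesis using assms by (simp add: field_simps of_nat_diff)
  qed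
  finally show ?thesis using assms by simp
qed

section \<open>Relations between inclusion vectors\<close>

text \<open>A relation that holds in every coordinate \<open>K\<close> survives pairing with any
  functional \<open>w\<close>; the proof exchanges the two sums.\<close>

lemma inclusion_relation_sum:
  fixes c :: "'a set \<Rightarrow> real"
  assumes "finite V" "\<And>A. A \<in> G \<Longrightarrow> A \<subseteq> V"
    and rel: "\<And>K. K \<in> nsets V k \<Longrightarrow> (\<Sum>A\<in>G. c A * of_bool (K \<subseteq> A)) = 0"
  shows "(\<Sum>A\<in>G. c A * (\<Sum>K\<in>nsets A k. w K)) = 0"
proof -
  have "(\<Sum>K\<in>nsets A k. w K) = (\<Sum>K\<in>nsets V k. of_bool (K \<subseteq> A) * w K)" if "A \<in> G" for A
  proof -
    have "nsets A k = {K \<in> nsets V k. K \<subseteq> A}"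
      using assms(2)[OF that] by (auto simp: nsets_def)
    then show ?thesis using assms(1) by (simp add: finite_imp_finite_nsets sum.inter_filter of_bool_def if_distrib[of "\<lambda>x. x * _"] cong: if_cong)
  qed
  then have "(\<Sum>A\<in>G. c A * (\<Sum>K\<in>nsets A k. w K)) =
      (\<Sum>A\<in>G. \<Sum>K\<in>nsets V k. c A * of_bool (K \<subseteq> A) * w K)"
    by (intro sum.cong) (simp_all add: sum_distrib_left mult.assoc)
  also have "\<dots> = (\<Sum>K\<in>nsets V k. \<Sum>A\<in>G. c A * of_bool (K \<subseteq> A) * w K)"
    by (rule sum.swap)
  also have "\<dots> = (\<Sum>K\<in>nsets V k. (\<Sum>A\<in>G. c A * of_bool (K \<subseteq> A)) * w K)"
    by (simp only: sum_distrib_right)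
  also have "\<dots> = 0"
  proof (rule sum.neutral, rule ballI)
    fix K assume "K \<in> nsets V k"
    then show "(\<Sum>A\<in>G. c A * of_bool (K \<subseteq> A)) * w K = 0" by (simp only: rel mult_zero_left)
  qed
  finally show ?thesis .
qed

text \<open>Pairing the relation with the functional of \<open>B\<close> kills every term except
  that of \<open>B\<close>.\<close>

lemma inclusion_relation_peel:
  fixes c :: "'a set \<Rightarrow> real"
  assumes "finite V" "finite G" "\<And>A. A \<in> G \<Longrightarrow> A \<subseteq> V"
    and rel: "\<And>K. K \<in> nsets V k \<Longrightarrow> (\<Sum>A\<in>G. c A * of_bool (K \<subseteq> A)) = 0"
    and B: "B \<in> G" "k \<le> card B"
    and other: "\<And>A. A \<in> G \<Longrightarrow> A \<noteq> B \<Longrightarrow> c A \<noteq> 0 \<Longrightarrow>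
      \<not> B \<subseteq> A \<and> card B \<le> card A \<and> card (A - B) \<le> k"
  shows "c B = 0"
proof -
  have fin: "finite A" if "A \<in> G" for A using assms that finite_subset by metis
  show ?thesis
  proof (cases "card B = k")
    \<comment> \<open>The functional requires \<open>k < card B\<close>. For a k-set the coordinate
      \<open>B\<close> itself does the same job.\<close>
    case True
    then have "B \<in> nsets V k" using B assms(3) fin by (auto simp: nsets_def)
    then have "0 = (\<Sum>A\<in>G. c A * of_bool (B \<subseteq> A))" using rel by simp
    also have "\<dots> = (\<Sum>A\<in>G. if A = B then c A else 0)"
      using other by (intro sum.cong) auto
    finally show ?thesis using B assms(2) by simp
  next
    case False
    have "0 = (\<Sum>A\<in>G. c A * (\<Sum>K\<in>nsets A k. test_weight B K))"
      using inclusion_relation_sum[OF assms(1,3) rel] by simp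
    also have "\<dots> = (\<Sum>A\<in>G. if A = B then c A * (\<Sum>K\<in>nsets B k. test_weight B K) else 0)"
    proof (rule sum.cong)
      fix A assume "A \<in> G"
      then have "c A = 0 \<or> (\<Sum>K\<in>nsets A k. test_weight B K) = 0" if "A \<noteq> B"
        using that False B fin other[of A] by (auto intro!: sum_test_weight_eq_0)
      then show "c A * (\<Sum>K\<in>nsets A k. test_weight B K) =
          (if A = B then c A * (\<Sum>K\<in>nsets B k. test_weight B K) else 0)" by auto
    qed simp
    finally show ?thesis using B False assms(2) fin by (auto simp: sum_test_weight_self)
  qed
qed

section \<open>Exchange closure and the differencing condition\<close>

text \<open>Take a member \<open>A\<close> of \<open>H\<close> with as few points outside the target
  \<open>C\<close> as possible: if any remained, a swap towards \<open>C\<close> would give a better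
  one.\<close>

lemma swap_closed_eq_nsets:
  assumes "finite S" "H \<subseteq> nsets S a" "H \<noteq> {}"
    and swap: "\<And>A i j. A \<in> H \<Longrightarrow> j \<in> A \<Longrightarrow> i \<in> S - A \<Longrightarrow> insert i (A - {j}) \<in> H"
  shows "H = nsets S a"
proof
  show "nsets S a \<subseteq> H"
  proof
    fix C assume C: "C \<in> nsets S a"
    obtain A where A: "A \<in> H" and min: "\<And>B. B \<in> H \<Longrightarrow> card (A - C) \<le> card (B - C)"
      using \<open>H \<noteq> {}\<close> ex_has_least_nat[of "\<lambda>A. A \<in> H" _ "\<lambda>A. card (A - C)"] by blast
    have fin: "finite A" "finite C" "card A = a" "card C = a" "C \<subseteq> S"
      using A C assms(2) by (auto simp: nsets_def)
    have "A - C = {}"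
    proof (rule ccontr)
      assume "A - C \<noteq> {}"
      then obtain j where j: "j \<in> A" "j \<notin> C" by blast
      have "\<not> C \<subseteq> A" using fin j card_subset_eq[of A C] by auto
      then obtain i where i: "i \<in> C" "i \<notin> A" by blast
      with A j fin have "insert i (A - {j}) \<in> H" by (intro swap) auto
      then have "card (A - C) \<le> card (insert i (A - {j}) - C)" by (rule min)
      also have "insert i (A - {j}) - C = (A - C) - {j}" using i by auto
      also have "card \<dots> < card (A - C)" using j fin by (intro psubset_card_mono) auto
      finally show False by simp
    qed
    then have "A = C" using fin by (intro card_subset_eq) auto
    then show "C \<in> H" using A by simp
  qed
qed (use assms in auto)

lemma differencingD:
  assumes "differencing k F" "A \<in> F" "B \<in> F" "A \<noteq> B"
  shows "card (A - B) \<le> k" "\<not> A \<subseteq> B" "\<not> B \<subseteq> A"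
proof -
  have "card (A - B) \<in> {1..k}" "card (B - A) \<in> {1..k}"
    using assms by (auto simp: differencing_def)
  then show "card (A - B) \<le> k" "\<not> A \<subseteq> B" "\<not> B \<subseteq> A"
    by (auto simp: Diff_eq_empty_iff[THEN iffD2])
qed

section \<open>Independence and the bound for sizes at least k\<close>

text \<open>Once all smaller members have coefficient zero, the surviving ones are at least as large
  as \<open>A\<close>, and peeling applies to \<open>A\<close>.\<close>

lemma differencing_inclusion_independent:
  fixes c :: "'a set \<Rightarrow> real"
  assumes "finite V" "F \<subseteq> Pow V" "differencing k F" "\<And>A. A \<in> F \<Longrightarrow> k \<le> card A"
    and rel: "\<And>K. K \<in> nsets V k \<Longrightarrow> (\<Sum>A\<in>F. c A * of_bool (K \<subseteq> A)) = 0"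
    and "A \<in> F"
  shows "c A = 0"
  using \<open>A \<in> F\<close>
proof (induction "card A" arbitrary: A rule: less_induct)
  case less
  have "finite F" using assms(1,2) by (simp add: finite_subset)
  show ?case
  proof (rule inclusion_relation_peel[OF assms(1) \<open>finite F\<close> _ rel])
    fix B assume B: "B \<in> F" "B \<noteq> A" "c B \<noteq> 0"
    then have "card A \<le> card B" using less.hyps by force
    then show "\<not> A \<subseteq> B \<and> card A \<le> card B \<and> card (B - A) \<le> k"
      using differencingD[OF assms(3) B(1) less.prems B(2)] by simp
  qed (use assms less.prems in auto)
qed

lemma differencing_card_le_of_large:
  assumes "finite V" "F \<subseteq> Pow V" "differencing k F" "\<And>A. A \<in> F \<Longrightarrow> k \<le> card A"
  shows "card F \<le> card V choose k"
proof (rule ccontr)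
  assume "\<not> card F \<le> card V choose k"
  then have "card (nsets V k) < card F" by (simp add: card_nsets)
  moreover have "finite F" using assms(1,2) by (simp add: finite_subset)
  ultimately obtain c :: "'a set \<Rightarrow> real" where "\<exists>A\<in>F. c A \<noteq> 0"
    and "\<forall>K\<in>nsets V k. (\<Sum>A\<in>F. c A * of_bool (K \<subseteq> A)) = 0"
    using underdetermined_system[of "nsets V k" F "\<lambda>A K. of_bool (K \<subseteq> A)"] assms(1)
    by (auto simp: finite_imp_finite_nsets)
  then show False using differencing_inclusion_independent[OF assms, of c] by auto
qed

section \<open>The top level in the case of equality\<close>

text \<open>One vector more than there are coordinates forces a relation. By independence of the
  members it must involve \<open>X\<close>, so it can be scaled to express the vector of
  \<open>X\<close> through those of \<open>F\<close>.\<close>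

lemma differencing_inclusion_span:
  assumes "finite V" "F \<subseteq> Pow V" "differencing k F" "\<And>A. A \<in> F \<Longrightarrow> k \<le> card A"
    and "card F = card V choose k" "X \<subseteq> V" "X \<notin> F"
  obtains c :: "'a set \<Rightarrow> real" where "c X = - 1"
    "\<And>K. K \<in> nsets V k \<Longrightarrow> (\<Sum>A\<in>insert X F. c A * of_bool (K \<subseteq> A)) = 0"
proof -
  have "finite F" using assms(1,2) by (simp add: finite_subset)
  then have "card (nsets V k) < card (insert X F)" using assms by (simp add: card_nsets)
  then obtain d :: "'a set \<Rightarrow> real" where nz: "\<exists>A\<in>insert X F. d A \<noteq> 0"
    and rel: "\<forall>K\<in>nsets V k. (\<Sum>A\<in>insert X F. d A * of_bool (K \<subseteq> A)) = 0"
    using underdetermined_system[of "nsets V k" "insert X F" "\<lambda>A K. of_bool (K \<subseteq> A)"]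
      assms(1) \<open>finite F\<close> by (auto simp: finite_imp_finite_nsets)
  have "d X \<noteq> 0"
  proof
    assume "d X = 0"
    with rel have "\<And>K. K \<in> nsets V k \<Longrightarrow> (\<Sum>A\<in>F. d A * of_bool (K \<subseteq> A)) = 0"
      unfolding sum.insert[OF \<open>finite F\<close> \<open>X \<notin> F\<close>] by simp
    with differencing_inclusion_independent[OF assms(1-4), of d] nz \<open>d X = 0\<close> show False by auto
  qed
  define c where "c = (\<lambda>A. - d A / d X)"
  have "(\<Sum>A\<in>insert X F. c A * of_bool (K \<subseteq> A)) = 0" if "K \<in> nsets V k" for K
  proof -
    have "(\<Sum>A\<in>insert X F. c A * of_bool (K \<subseteq> A)) =
        - (\<Sum>A\<in>insert X F. d A * of_bool (K \<subseteq> A)) / d X"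
      unfolding c_def sum_negf[symmetric] sum_divide_distrib by (intro sum.cong) auto
    then show ?thesis using rel that by simp
  qed
  moreover have "c X = - 1" using \<open>d X \<noteq> 0\<close> by (simp add: c_def)
  ultimately show thesis using that by blast
qed

text \<open>Members below the top level are peeled off first. For a member \<open>A\<close> of size
  \<open>a\<close>, the functional of \<open>A\<close> then sees only \<open>X\<close> and
  \<open>A\<close>, and comparing the two values gives the coefficient.\<close>

lemma top_shadow_relation:
  assumes "finite V" "F \<subseteq> Pow V" "differencing k F" "\<And>A. A \<in> F \<Longrightarrow> k \<le> card A"
    and "card F = card V choose k"
    and top: "T \<in> F" "card T = a" "k < a" "\<And>A. A \<in> F \<Longrightarrow> card A \<le> a"
    and j: "j \<in> T" and X: "X = T - {j}"
  obtains c :: "'a set \<Rightarrow> real" where "c X = - 1"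
    "\<And>K. K \<in> nsets V k \<Longrightarrow> (\<Sum>A\<in>insert X F. c A * of_bool (K \<subseteq> A)) = 0"
    "\<And>A. A \<in> F \<Longrightarrow> card A < a \<Longrightarrow> c A = 0"
    "\<And>A. A \<in> F \<Longrightarrow> card A = a \<Longrightarrow> c A =
      (-1) ^ card (X - A) * (real a - real k) / (real a * real ((a - 1) choose card (X - A)))"
proof -
  have "finite F" using assms(1,2) by (simp add: finite_subset)
  have fin: "finite A" if "A \<in> F" for A using assms(1,2) that finite_subset by blast
  have "X \<notin> F" using differencingD(2)[OF assms(3), of X T] top(1) j X by auto
  have card_X: "Suc (card X) = a" using top fin j X by (metis card.remove)
  have "X \<subseteq> V" using assms(2) top X by auto
  have X_diff: "card (X - A) \<le> k" if "A \<in> F" for A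
  proof (cases "A = T")
    case False
    have "card (X - A) \<le> card (T - A)" using fin top X by (intro card_mono) auto
    then show ?thesis using differencingD(1)[OF assms(3) top(1) that] False by simp
  qed (use X in \<open>simp add: Diff_eq_empty_iff[THEN iffD2]\<close>)
  obtain c :: "'a set \<Rightarrow> real" where cX: "c X = - 1" and
    rel: "\<And>K. K \<in> nsets V k \<Longrightarrow> (\<Sum>A\<in>insert X F. c A * of_bool (K \<subseteq> A)) = 0"
    using differencing_inclusion_span[OF assms(1-5) \<open>X \<subseteq> V\<close> \<open>X \<notin> F\<close>] by blast
  have lower: "c A = 0" if "A \<in> F" "card A < a" for A
    using that
  proof (induction "card A" arbitrary: A rule: less_induct)
    case less
    show ?case
    proof (rule inclusion_relation_peel[OF assms(1) _ _ rel])
      fix B assume B: "B \<in> insert X F" "B \<noteq> A" "c B \<noteq> 0"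
      show "\<not> A \<subseteq> B \<and> card A \<le> card B \<and> card (B - A) \<le> k"
      proof (cases "B = X")
        case True
        \<comment> \<open>\<open>X\<close> is not a member, so incomparability with \<open>A\<close>
          is borrowed from \<open>T\<close>, which contains \<open>X\<close>.\<close>
        have "\<not> A \<subseteq> T"
          using differencingD(2)[OF assms(3) less.prems(1) top(1)] less.prems(2) top(2) by auto
        then show ?thesis using True X X_diff less.prems card_X by auto
      next
        case False
        with B have "B \<in> F" by simp
        have "card A \<le> card B" using less \<open>B \<in> F\<close> B(3) by force
        then show ?thesis
          using differencingD[OF assms(3) \<open>B \<in> F\<close> less.prems(1) B(2)] by simp
      qed
    qed (use assms(2,4) less.prems \<open>finite F\<close> \<open>X \<subseteq> V\<close> in auto)
  qed
  have upper: "c A = (-1) ^ card (X - A) * (real a - real k) / (real a * real ((a - 1) choose card (X - A)))"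
    if A: "A \<in> F" "card A = a" for A
  proof -
    let ?S = "\<lambda>B. \<Sum>K\<in>nsets B k. test_weight A K"
    have "0 = (\<Sum>B\<in>insert X F. c B * ?S B)"
      using inclusion_relation_sum[OF assms(1) _ rel, where w = "test_weight A"] assms(2) \<open>X \<subseteq> V\<close> by auto
    also have "\<dots> = - ?S X + (\<Sum>B\<in>F. c B * ?S B)"
      using \<open>finite F\<close> \<open>X \<notin> F\<close> cX by simp
    also have "(\<Sum>B\<in>F. c B * ?S B) = (\<Sum>B\<in>F. if B = A then c A * ?S A else 0)"
    proof (rule sum.cong)
      fix B assume B: "B \<in> F"
      have "c B * ?S B = 0" if "B \<noteq> A"
      proof (cases "card B < a")
        case False
        \<comment> \<open>As no member exceeds size \<open>a\<close>, \<open>B\<close> has the same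
          size as \<open>A\<close> here.\<close>
        then have "?S B = 0"
          using differencingD[OF assms(3) B A(1) that] A B fin top(3)
          by (intro sum_test_weight_eq_0) auto
        then show ?thesis by simp
      qed (simp add: lower B)
      then show "c B * ?S B = (if B = A then c A * ?S A else 0)" by auto
    qed simp
    also have "\<dots> = c A * ?S A" using A \<open>finite F\<close> by simp
    also have "?S A = (-1) ^ k * real a / (real a - real k)"
      using sum_test_weight_self[of A k] A fin top(3) by simp
    also have "?S X = (-1) ^ (k + card (X - A)) / real (card X choose card (X - A))"
      using A fin X_diff top card_X X by (intro sum_test_weight_smaller) auto
    also have "card X = a - 1" using card_X by simp
    finally have "c A * real a / (real a - real k) =
        (-1) ^ card (X - A) / real ((a - 1) choose card (X - A))"
      by (cases "even k") (simp_all add: power_add)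
    moreover have "real a - real k > 0" "real a > 0" "real ((a - 1) choose card (X - A)) > 0"
      using top(3) X_diff[OF A(1)] by auto
    ultimately show ?thesis by (simp add: field_simps)
  qed
  show thesis using that[OF cX rel lower upper] .
qed

lemma sum_nsets_superset:
  assumes "finite A" "finite J" "card J \<le> k"
  shows "(\<Sum>K\<in>nsets A k. of_bool (J \<subseteq> K) :: real) =
    of_bool (J \<subseteq> A) * real ((card A - card J) choose (k - card J))"
proof -
  have sub: "J \<subseteq> K \<longleftrightarrow> card (K \<inter> J) = card J" for K
    using assms(2) by (metis Int_absorb1 card_subset_eq inf_le1 inf_le2)
  have "(\<Sum>K\<in>nsets A k. of_bool (J \<subseteq> K) :: real) =
      (\<Sum>t\<le>k. real (card (A \<inter> J) choose t) * real (card (A - J) choose (k - t)) * of_bool (t = card J))"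
    unfolding sub using assms(1) by (rule sum_nsets_card_Int)
  also have "\<dots> = (\<Sum>t\<le>k. if t = card J
      then real (card (A \<inter> J) choose t) * real (card (A - J) choose (k - t)) else 0)"
    by (intro sum.cong) auto
  also have "\<dots> = real (card (A \<inter> J) choose card J) * real (card (A - J) choose (k - card J))"
    using assms(3) by simp
  also have "\<dots> = of_bool (J \<subseteq> A) * real ((card A - card J) choose (k - card J))"
  proof (cases "J \<subseteq> A")
    case True
    then show ?thesis using assms by (simp add: Int_absorb1 card_Diff_subset)
  next
    case False
    then have "card (A \<inter> J) < card J" using assms(2) by (intro psubset_card_mono) auto
    then show ?thesis using False by (simp add: binomial_eq_0)
  qed
  finally show ?thesis .
qed

text \<open>Multiplying by card (A \<inter> X) amounts to summing over y in \<open>X\<close> with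
  \<open>J\<close> enlarged by y, so each linear factor costs at most one point of \<open>J\<close>.
  Without factors the relation is paired with the indicator of K \<supseteq> J, which vanishes on
  the side of \<open>X\<close> because \<open>J\<close> is not contained in
  \<open>X\<close>.\<close>

lemma top_shadow_moments:
  fixes c :: "'a set \<Rightarrow> real"
  assumes "finite X" "finite H" "\<And>A. A \<in> H \<Longrightarrow> finite A \<and> card A = a" "k < a"
    and rel: "\<And>w. (\<Sum>A\<in>H. c A * (\<Sum>K\<in>nsets A k. w K)) = (\<Sum>K\<in>nsets X k. w K)"
    and "finite J" "\<not> J \<subseteq> X" "finite L" "card J + card L \<le> k"
  shows "(\<Sum>A\<in>H. c A * of_bool (J \<subseteq> A) * (\<Prod>l\<in>L. real (card (A \<inter> X)) - real l)) = 0"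
  using assms(8,6,7,9)
proof (induction L arbitrary: J rule: finite_induct)
  case empty
  let ?m = "real ((a - card J) choose (k - card J))"
  have "(\<Sum>A\<in>H. c A * of_bool (J \<subseteq> A)) * ?m = (\<Sum>A\<in>H. c A * (\<Sum>K\<in>nsets A k. of_bool (J \<subseteq> K)))"
    unfolding sum_distrib_right using assms(3) empty
    by (intro sum.cong) (simp_all add: sum_nsets_superset)
  also have "\<dots> = 0"
    unfolding rel using empty assms(1) by (simp add: sum_nsets_superset)
  \<comment> \<open>The factor \<open>?m\<close> can be cancelled: it is nonzero because
    \<open>k < a\<close>.\<close>
  finally show ?case using diff_le_mono[of k a "card J"] \<open>k < a\<close> by auto
next
  case (insert l L)
  let ?P = "\<lambda>A. \<Prod>l\<in>L. real (card (A \<inter> X)) - real l"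
  have card_Int: "c A * of_bool (J \<subseteq> A) * (real (card (A \<inter> X)) * ?P A) =
      (\<Sum>y\<in>X. c A * of_bool (insert y J \<subseteq> A) * ?P A)" for A
  proof -
    have "A \<inter> X = {y \<in> X. y \<in> A}" by auto
    then have "real (card (A \<inter> X)) = (\<Sum>y\<in>X. of_bool (y \<in> A))"
      using \<open>finite X\<close> by (simp add: of_bool_def flip: sum.inter_filter)
    then show ?thesis by (simp only: sum_distrib_right sum_distrib_left) (auto intro!: sum.cong)
  qed
  have "(\<Sum>A\<in>H. c A * of_bool (J \<subseteq> A) * (real (card (A \<inter> X)) * ?P A)) =
      (\<Sum>A\<in>H. \<Sum>y\<in>X. c A * of_bool (insert y J \<subseteq> A) * ?P A)"
    by (simp only: card_Int)
  also have "\<dots> = (\<Sum>y\<in>X. \<Sum>A\<in>H. c A * of_bool (insert y J \<subseteq> A) * ?P A)"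
    by (rule sum.swap)
  also have "\<dots> = 0"
  proof (rule sum.neutral, rule ballI)
    fix y assume "y \<in> X"
    have "card (insert y J) \<le> Suc (card J)" by (simp add: card_insert_le_m1 card_insert_if)
    then show "(\<Sum>A\<in>H. c A * of_bool (insert y J \<subseteq> A) * ?P A) = 0"
      using insert.prems insert.hyps by (intro insert.IH) auto
  qed
  finally have "(\<Sum>A\<in>H. c A * of_bool (J \<subseteq> A) * (real (card (A \<inter> X)) * ?P A)) = 0" .
  moreover have "(\<Sum>A\<in>H. c A * of_bool (J \<subseteq> A) * ?P A) = 0"
    using insert.prems insert.hyps by (intro insert.IH) auto
  ultimately show ?case
    using insert.hyps
    by (simp add: left_diff_distrib right_diff_distrib sum_subtractf mult.left_commute[of _ "real l"]
        flip: sum_distrib_left)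
qed

text \<open>If X + i were not a member, the moments with \<open>J = {i}\<close> would vanish for
  every product of up to k - 1 linear factors. Choosing the factors to leave one value of card (X -
  A), where all coefficients agree, forces a nonempty set of members to be empty.\<close>

lemma top_level_swap_closed:
  assumes "finite V" "F \<subseteq> Pow V" "differencing k F" "\<And>A. A \<in> F \<Longrightarrow> k \<le> card A"
    and "card F = card V choose k"
    and top: "T \<in> F" "card T = a" "k < a" "\<And>A. A \<in> F \<Longrightarrow> card A \<le> a"
    and j: "j \<in> T" and i: "i \<in> R" "R \<in> F" "card R = a" "i \<notin> T"
  shows "insert i (T - {j}) \<in> F"
proof (rule ccontr)
  assume new: "insert i (T - {j}) \<notin> F"
  define X where "X = T - {j}"
  define H where "H = {A \<in> F. card A = a}"
  have "finite F" using assms(1,2) by (simp add: finite_subset)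
  have fin: "finite A" if "A \<in> F" for A using assms(1,2) that finite_subset by blast
  have "finite H" "finite X" using \<open>finite F\<close> fin top X_def by (auto simp: H_def)
  have X: "Suc (card X) = a" "i \<notin> X" using top fin j i X_def by (auto simp: card_Suc_Diff1)
  obtain c where c: "c X = - 1"
    "\<And>K. K \<in> nsets V k \<Longrightarrow> (\<Sum>A\<in>insert X F. c A * of_bool (K \<subseteq> A)) = 0"
    "\<And>A. A \<in> F \<Longrightarrow> card A < a \<Longrightarrow> c A = 0"
    "\<And>A. A \<in> F \<Longrightarrow> card A = a \<Longrightarrow> c A =
      (-1) ^ card (X - A) * (real a - real k) / (real a * real ((a - 1) choose card (X - A)))"
    using top_shadow_relation[OF assms(1-10) X_def] by blast
  have "X \<notin> F" using differencingD(2)[OF assms(3), of X T] top(1) j X_def by auto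
  have rel: "(\<Sum>A\<in>H. c A * (\<Sum>K\<in>nsets A k. w K)) = (\<Sum>K\<in>nsets X k. w K)" for w :: "'a set \<Rightarrow> real"
  proof -
    have "0 = (\<Sum>A\<in>insert X F. c A * (\<Sum>K\<in>nsets A k. w K))"
      using inclusion_relation_sum[OF assms(1) _ c(2), where w = w] assms(2) top(1) X_def by auto
    also have "\<dots> = - (\<Sum>K\<in>nsets X k. w K) + (\<Sum>A\<in>F. c A * (\<Sum>K\<in>nsets A k. w K))"
      using \<open>finite F\<close> \<open>X \<notin> F\<close> c(1) by simp
    also have "(\<Sum>A\<in>F. c A * (\<Sum>K\<in>nsets A k. w K)) = (\<Sum>A\<in>H. c A * (\<Sum>K\<in>nsets A k. w K))"
      using \<open>finite F\<close> c(3) top(4) by (intro sum.mono_neutral_right) (force simp: H_def)+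
    finally show ?thesis by simp
  qed
  \<comment> \<open>The value 0 is excluded since \<open>X \<subseteq> A\<close> would make
    \<open>A\<close> the missing set X + i. So only \<open>k\<close> values are possible.\<close>
  have r: "card (X - A) \<in> {1..k} \<and> card (A \<inter> X) = a - 1 - card (X - A)" if "A \<in> H" "i \<in> A" for A
  proof -
    have A: "A \<in> F" "card A = a" using that by (auto simp: H_def)
    have "\<not> X \<subseteq> A"
    proof
      assume "X \<subseteq> A"
      then have "insert i X = A" using A fin X \<open>i \<in> A\<close> \<open>finite X\<close> by (intro card_subset_eq) auto
      then show False using new A(1) X_def by simp
    qed
    then have pos: "card (X - A) \<ge> 1"
      using \<open>finite X\<close> by (simp add: Suc_le_eq card_gt_0_iff)
    have "A \<noteq> T" using \<open>i \<in> A\<close> i by auto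
    then have "card (T - A) \<le> k" using differencingD(1)[OF assms(3) top(1) A(1)] by auto
    moreover have "card (X - A) \<le> card (T - A)"
      using fin top by (intro card_mono) (auto simp: X_def)
    ultimately have "card (X - A) \<le> k" by simp
    moreover have "card X = card (A \<inter> X) + card (X - A)"
      using \<open>finite X\<close> by (metis Int_commute card_Int_Diff)
    ultimately show ?thesis using X(1) pos by auto
  qed
  define p where "p = card (X - R)"
  \<comment> \<open>The roots are the values of card (A \<inter> X) that belong to the k - 1
    differences other than \<open>p\<close>. Together with the point \<open>i\<close> this exhausts
    the allowance \<open>card J + card L \<le> k\<close>.\<close>
  define L where "L = (\<lambda>r. a - 1 - r) ` ({1..k} - {p})"
  have p: "p \<in> {1..k}" using r[of R] i by (simp add: p_def H_def)
  have "inj_on (\<lambda>r. a - 1 - r) ({1..k} - {p})" using top(3) by (auto simp: inj_on_def)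
  then have "card L = k - 1"
    unfolding L_def using p by (simp add: card_image)
  have "finite L" by (simp add: L_def)
  define P where "P = (\<Prod>l\<in>L. real (a - 1 - p) - real l)"
  have "P \<noteq> 0"
    using \<open>finite L\<close> p top(3) by (auto simp: P_def L_def)
  define C where "C = (-1) ^ p * (real a - real k) / (real a * real ((a - 1) choose p))"
  have "p \<le> a - 1" using top(3) p by auto
  then have "C \<noteq> 0" using top(3) by (simp add: C_def)
  define M where "M = {A \<in> H. i \<in> A \<and> card (X - A) = p}"
  have "0 = (\<Sum>A\<in>H. c A * of_bool ({i} \<subseteq> A) * (\<Prod>l\<in>L. real (card (A \<inter> X)) - real l))"
    using fin X \<open>card L = k - 1\<close> p top(3) \<open>finite L\<close>
    by (intro top_shadow_moments[symmetric, OF \<open>finite X\<close> \<open>finite H\<close> _ _ rel, of a]) (auto simp: H_def)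
  \<comment> \<open>Outside \<open>M\<close> either \<open>i\<close> is missing or the polynomial
    has a root; on \<open>M\<close> coefficient and polynomial are constant.\<close>
  also have "\<dots> = (\<Sum>A\<in>M. C * P)"
  proof (rule sum.mono_neutral_cong_right)
    show "\<forall>A\<in>H - M. c A * of_bool ({i} \<subseteq> A) * (\<Prod>l\<in>L. real (card (A \<inter> X)) - real l) = 0"
    proof
      fix A assume A: "A \<in> H - M"
      have "(\<Prod>l\<in>L. real (card (A \<inter> X)) - real l) = 0" if "i \<in> A"
      proof -
        have "card (X - A) \<in> {1..k} - {p}" using r[of A] A that by (auto simp: M_def)
        then have "card (A \<inter> X) \<in> L" using r[of A] A that by (auto simp: L_def)
        then show ?thesis using \<open>finite L\<close> by auto
      qed
      then show "c A * of_bool ({i} \<subseteq> A) * (\<Prod>l\<in>L. real (card (A \<inter> X)) - real l) = 0" by auto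
    qed
    show "c A * of_bool ({i} \<subseteq> A) * (\<Prod>l\<in>L. real (card (A \<inter> X)) - real l) = C * P" if "A \<in> M" for A
      using that r[of A] c(4)[of A] by (simp add: M_def H_def C_def P_def)
  qed (auto simp: M_def \<open>finite H\<close>)
  finally have "card M = 0" using \<open>C \<noteq> 0\<close> \<open>P \<noteq> 0\<close> by simp
  moreover have "R \<in> M" using i by (simp add: M_def H_def p_def)
  ultimately show False using \<open>finite H\<close> by (auto simp: M_def)
qed

section \<open>Extremal families with all sizes at least k\<close>

lemma ex_nsets_large_Diff:
  assumes "finite S" "a \<le> card S" "m \<le> a" "m \<le> card (S - B)"
  shows "\<exists>A\<in>nsets S a. m \<le> card (A - B)"
proof -
  obtain Q where Q: "Q \<subseteq> S - B" "card Q = m" "finite Q"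
    using assms(4) obtain_subset_with_card_n by blast
  obtain A where "Q \<subseteq> A" "A \<subseteq> S" "card A = a"
    using exists_subset_between[of Q a S] Q assms by auto
  moreover have "Q \<subseteq> A - B" using Q \<open>Q \<subseteq> A\<close> by auto
  moreover have "finite A" using \<open>A \<subseteq> S\<close> assms(1) finite_subset by auto
  ultimately show ?thesis using Q(2) card_mono[of "A - B" Q] by (auto simp: nsets_def)
qed

text \<open>Each new set lies inside a member of size \<open>a\<close> and inherits from it the
  incomparability with, and the small difference to, the remaining members. These have size at most
  a - 1, which controls the opposite difference.\<close>

lemma differencing_lower_level:
  assumes "finite S" "differencing k F" "\<And>A. A \<in> F \<Longrightarrow> finite A \<and> card A \<le> a"
    and H: "{A \<in> F. card A = a} = nsets S a" and S: "a \<le> card S" "card S < a + k" and "1 \<le> a"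
  shows "differencing k ((F - nsets S a) \<union> nsets S (a - 1))"
    and "F \<inter> nsets S (a - 1) = {}"
proof -
  have above: "\<exists>A\<in>F. Y \<subset> A \<and> card A = a" if "Y \<in> nsets S (a - 1)" for Y
  proof -
    have Y: "Y \<subseteq> S" "finite Y" "card Y = a - 1" using that by (auto simp: nsets_def)
    then have "\<not> S \<subseteq> Y" using S(1) \<open>1 \<le> a\<close> card_mono[of Y S] by auto
    then obtain i where "i \<in> S" "i \<notin> Y" by blast
    then have "insert i Y \<in> nsets S a" using Y \<open>1 \<le> a\<close> by (auto simp: nsets_def)
    then show ?thesis using H \<open>i \<notin> Y\<close> by blast
  qed
  show disj: "F \<inter> nsets S (a - 1) = {}"
    using above differencingD(2)[OF assms(2)] by blast
  have cross: "card (Y - B) \<in> {1..k} \<and> card (B - Y) \<in> {1..k}"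
    if Y: "Y \<in> nsets S (a - 1)" and B: "B \<in> F - nsets S a" for Y B
  proof -
    obtain A where A: "A \<in> F" "Y \<subset> A" "card A = a" using above[OF Y] by blast
    have "A \<in> nsets S a" using A H by blast
    then have "B \<noteq> A" using B by blast
    have fin: "finite Y" "finite B" "finite A" using Y A B assms(3) by (auto simp: nsets_def)
    have "card B \<noteq> a" using B H by blast
    then have le: "card B \<le> card Y" using B assms(3) Y by (force simp: nsets_def)
    have "\<not> B \<subseteq> Y" using differencingD(3)[OF assms(2) A(1), of B] B \<open>B \<noteq> A\<close> A(2) by auto
    moreover from this have "\<not> Y \<subseteq> B" using le fin card_seteq[of B Y] by auto
    moreover have "card (Y - B) \<le> k"
      using differencingD(1)[OF assms(2) A(1), of B] B \<open>B \<noteq> A\<close> A(2) fin card_mono[of "A - B" "Y - B"]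
      by fastforce
    moreover have "card (B - Y) \<le> card (Y - B)" using le fin by (simp add: card_le_sym_Diff)
    ultimately show ?thesis using fin by (simp add: Suc_le_eq card_gt_0_iff)
  qed
  have level: "card (Y - Z) \<in> {1..k}" if YZ: "Y \<in> nsets S (a - 1)" "Z \<in> nsets S (a - 1)" "Y \<noteq> Z" for Y Z
  proof -
    have "\<not> Y \<subseteq> Z" using YZ card_subset_eq[of Z Y] by (auto simp: nsets_def)
    moreover have "card (Y - Z) \<le> card (S - Z)"
      using YZ assms(1) by (intro card_mono) (auto simp: nsets_def)
    \<comment> \<open>Here card (S - Z) = card S - (a - 1), and \<open>card S < a + k\<close> is
      exactly what is required.\<close>
    moreover have "card (S - Z) \<le> k"
      using YZ S \<open>1 \<le> a\<close> by (auto simp: nsets_def card_Diff_subset)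
    moreover have "finite Y" using YZ by (simp add: nsets_def)
    ultimately show ?thesis by (simp add: Suc_le_eq card_gt_0_iff)
  qed
  show "differencing k ((F - nsets S a) \<union> nsets S (a - 1))"
    using cross level assms(2) unfolding differencing_def by blast
qed

lemma differencing_extremal_of_large:
  assumes "finite V" "F \<subseteq> Pow V" "differencing k F" "\<And>A. A \<in> F \<Longrightarrow> k \<le> card A"
    and card_F: "card F = card V choose k" and "1 \<le> k"
  shows "F = nsets V k \<or> F = nsets V (card V - k)"
proof -
  have "finite F" using assms(1,2) by (simp add: finite_subset)
  have fin: "finite A" if "A \<in> F" for A using assms(1,2) that finite_subset by blast
  show ?thesis
  proof (cases "F \<subseteq> nsets V k")
    case True
    then have "F = nsets V k"
      using assms(1) card_F by (intro card_subset_eq) (simp_all add: finite_imp_finite_nsets card_nsets)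
    then show ?thesis ..
  next
    case False
    then obtain A0 where A0: "A0 \<in> F" "card A0 \<noteq> k"
      using assms(2) fin by (auto simp: nsets_def)
    define a where "a = Max (card ` F)"
    have max: "card A \<le> a" if "A \<in> F" for A using \<open>finite F\<close> that by (simp add: a_def)
    have "a \<in> card ` F" unfolding a_def using \<open>finite F\<close> A0 by (intro Max_in) auto
    then obtain T where T: "T \<in> F" "card T = a" by auto
    have "k < a" using A0 assms(4)[of A0] max[of A0] by simp
    define H where "H = {A \<in> F. card A = a}"
    define S where "S = \<Union>H"
    have "S \<subseteq> V" using assms(2) by (auto simp: S_def H_def)
    then have "finite S" using assms(1) finite_subset by blast
    have "H = nsets S a"
    proof (rule swap_closed_eq_nsets[OF \<open>finite S\<close>])
      show "H \<subseteq> nsets S a" using fin by (auto simp: H_def S_def nsets_def)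
      show "H \<noteq> {}" using T by (auto simp: H_def)
      fix A i j assume A: "A \<in> H" and j: "j \<in> A" and i: "i \<in> S - A"
      obtain R where R: "R \<in> F" "card R = a" "i \<in> R" using i by (auto simp: S_def H_def)
      have "insert i (A - {j}) \<in> F"
        using A i by (intro top_level_swap_closed[OF assms(1-5) _ _ \<open>k < a\<close> max j R(3,1,2)]) (auto simp: H_def)
      moreover have "card (insert i (A - {j})) = a"
        using A i j fin card_Suc_Diff1[of A j] by (auto simp: H_def card_insert_if)
      ultimately show "insert i (A - {j}) \<in> H" by (simp add: H_def)
    qed
    have "T \<subseteq> S" using T by (auto simp: S_def H_def)
    then have "a \<le> card S" using card_mono[OF \<open>finite S\<close>] T by blast
    \<comment> \<open>All a-subsets of \<open>S\<close> are members, and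
      \<open>a \<ge> k + 1\<close>. So k + 1 points of S - B could be completed to a member too far
      from \<open>B\<close>.\<close>
    have large: "card (S - B) \<le> k" if B: "B \<in> F" for B
    proof (rule ccontr)
      assume gt: "\<not> card (S - B) \<le> k"
      then obtain A where A: "A \<in> nsets S a" "Suc k \<le> card (A - B)"
        using ex_nsets_large_Diff[OF \<open>finite S\<close> \<open>a \<le> card S\<close>, of "Suc k" B] \<open>k < a\<close> by auto
      then have "A \<in> F" "A \<noteq> B" using \<open>H = nsets S a\<close> by (auto simp: H_def)
      then show False using differencingD(1)[OF assms(3) _ B] A(2) by fastforce
    qed
    have "card S \<le> a + k"
      using large[OF T(1)] \<open>T \<subseteq> S\<close> T fin by (simp add: card_Diff_subset)
    have "card S = a + k"
    proof (rule ccontr)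
      assume "card S \<noteq> a + k"
      then have "card S < a + k" using \<open>card S \<le> a + k\<close> by simp
      let ?G = "(F - nsets S a) \<union> nsets S (a - 1)"
      have lower: "differencing k ?G" "F \<inter> nsets S (a - 1) = {}"
        using differencing_lower_level[OF \<open>finite S\<close> assms(3) _ _ \<open>a \<le> card S\<close> \<open>card S < a + k\<close>]
          fin max \<open>H = nsets S a\<close> \<open>k < a\<close> by (auto simp: H_def)
      have "?G \<subseteq> Pow V" using assms(2) \<open>S \<subseteq> V\<close> by (auto simp: nsets_def)
      moreover have "k \<le> card A" if "A \<in> ?G" for A
        using that assms(4) \<open>k < a\<close> by (auto simp: nsets_def)
      ultimately have "card ?G \<le> card V choose k"
        using differencing_card_le_of_large[OF assms(1) _ lower(1)] by blast
      moreover have "card ?G = card (F - nsets S a) + (card S choose (a - 1))"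
        using \<open>finite F\<close> \<open>finite S\<close> lower(2)
        by (subst card_Un_disjoint) (auto simp: finite_imp_finite_nsets card_nsets)
      moreover have "F \<inter> nsets S a = nsets S a" using \<open>H = nsets S a\<close> by (auto simp: H_def)
      then have "card F = card (F - nsets S a) + (card S choose a)"
        using card_Int_Diff[OF \<open>finite F\<close>, of "nsets S a"] by (simp add: card_nsets)
      \<comment> \<open>Both indices lie in the decreasing half of the row: card S \<le> a + k - 1
        \<le> 2 (a - 1).\<close>
      moreover have "card S choose a < card S choose (a - 1)"
        using \<open>k < a\<close> \<open>card S < a + k\<close> \<open>a \<le> card S\<close> by (intro binomial_strict_antimono) auto
      ultimately show False using card_F by simp
    qed
    have "F = nsets S a"
    proof -
      \<comment> \<open>At most \<open>k\<close> of the a + k points of \<open>S\<close> are missing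
        from \<open>B\<close>, so \<open>B\<close> has at least \<open>a\<close> points, the largest
        size.\<close>
      have "card B = a" if "B \<in> F" for B
      proof -
        have "card S = card (S \<inter> B) + card (S - B)" using \<open>finite S\<close> by (rule card_Int_Diff)
        moreover have "card (S \<inter> B) \<le> card B" using fin that by (intro card_mono) auto
        ultimately show ?thesis using large[OF that] max[OF that] \<open>card S = a + k\<close> by simp
      qed
      then show ?thesis using \<open>H = nsets S a\<close> by (auto simp: H_def)
    qed
    have "S = V"
    \<comment> \<open>By symmetry \<open>card F\<close> is the binomial of \<open>card S\<close>
      over \<open>k\<close>, which would be too small if \<open>S\<close> missed a point of
      \<open>V\<close>.\<close>
    proof (rule ccontr)
      assume "S \<noteq> V"
      then obtain v where "v \<in> V" "v \<notin> S" using \<open>S \<subseteq> V\<close> by auto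
      then have "card S \<le> card (V - {v})" using assms(1) \<open>S \<subseteq> V\<close> by (intro card_mono) auto
      then obtain m where m: "card V = Suc m" "card S \<le> m"
        using \<open>v \<in> V\<close> assms(1) by (cases "card V") auto
      have "card S choose k \<le> m choose k" using m by (simp add: binomial_right_mono)
      moreover have "m choose k < Suc m choose k"
        using \<open>1 \<le> k\<close> m \<open>card S = a + k\<close> by (cases k) auto
      moreover have "card S choose a = card S choose k"
        using \<open>card S = a + k\<close> binomial_symmetric[of a "a + k"] by simp
      ultimately show False using card_F \<open>F = nsets S a\<close> m by (simp add: card_nsets)
    qed
    then show ?thesis using \<open>F = nsets S a\<close> \<open>card S = a + k\<close> by auto
  qed
qed

section \<open>Raising the lowest level\<close>

definition upper_shadow :: "'a set \<Rightarrow> nat \<Rightarrow> 'a set set \<Rightarrow> 'a set set" where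
  "upper_shadow V s H = {Y \<in> nsets V (Suc s). \<exists>A\<in>H. A \<subseteq> Y}"

text \<open>Double counting of pairs A \<subseteq> Y: each \<open>A\<close> has card V - s
  extensions, each \<open>Y\<close> has at most s + 1 subsets in \<open>H\<close>. Equality means
  that no \<open>Y\<close> misses any of its s-subsets.\<close>

lemma upper_shadow_card:
  assumes "finite V" "H \<subseteq> nsets V s"
  shows "(card V - s) * card H \<le> Suc s * card (upper_shadow V s H)"
    and "\<lbrakk>(card V - s) * card H = Suc s * card (upper_shadow V s H); Y \<in> upper_shadow V s H\<rbrakk>
      \<Longrightarrow> nsets Y s \<subseteq> H"
proof -
  let ?U = "upper_shadow V s H" and ?below = "\<lambda>Y. {A \<in> H. A \<subseteq> Y}"
  have fin: "finite H" "finite ?U"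
    using assms by (auto simp: upper_shadow_def finite_imp_finite_nsets intro: finite_subset)
  have up: "card {Y \<in> ?U. A \<subseteq> Y} = card V - s" if "A \<in> H" for A
  proof -
    have A: "A \<subseteq> V" "finite A" "card A = s" using that assms by (auto simp: nsets_def)
    have "{Y \<in> ?U. A \<subseteq> Y} = (\<lambda>i. insert i A) ` (V - A)"
    proof (rule set_eqI, rule iffI)
      fix Y assume "Y \<in> {Y \<in> ?U. A \<subseteq> Y}"
      then have Y: "Y \<subseteq> V" "A \<subseteq> Y" "card (Y - A) = 1" "finite Y"
        using A by (auto simp: upper_shadow_def nsets_def card_Diff_subset)
      then obtain i where "Y - A = {i}" by (auto simp: card_1_singleton_iff)
      then have "Y = insert i A" "i \<in> V - A" using Y by auto
      then show "Y \<in> (\<lambda>i. insert i A) ` (V - A)" by blast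
    qed (use A that in \<open>auto simp: upper_shadow_def nsets_def\<close>)
    moreover have "inj_on (\<lambda>i. insert i A) (V - A)" by (auto simp: inj_on_def)
    ultimately show ?thesis using A by (simp add: card_image card_Diff_subset)
  qed
  have below: "?below Y \<subseteq> nsets Y s" "finite (nsets Y s)" "card (nsets Y s) = Suc s" if "Y \<in> ?U" for Y
    using that assms by (auto simp: upper_shadow_def nsets_def[of V] card_nsets finite_imp_finite_nsets)
      (auto simp: nsets_def)
  have le: "card (?below Y) \<le> Suc s" if "Y \<in> ?U" for Y
    using below[OF that] card_mono by metis
  have "(\<Sum>A\<in>H. card {Y \<in> ?U. A \<subseteq> Y}) = (\<Sum>Y\<in>?U. card (?below Y))"
    using fin by (intro sum_multicount_gen) auto
  then have count: "(card V - s) * card H = (\<Sum>Y\<in>?U. card (?below Y))"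
    using up by (simp add: mult.commute)
  show "(card V - s) * card H \<le> Suc s * card ?U"
    unfolding count using sum_bounded_above[of ?U "\<lambda>Y. card (?below Y)" "Suc s"] le
    by (simp add: mult.commute)
  assume eq: "(card V - s) * card H = Suc s * card ?U" and Y: "Y \<in> ?U"
  have "card (?below Y) = Suc s"
  proof (rule ccontr)
    assume "card (?below Y) \<noteq> Suc s"
    then have "card (?below Y) < Suc s" using le[OF Y] by simp
    then have "(\<Sum>Y\<in>?U. card (?below Y)) < (\<Sum>Y\<in>?U. Suc s)"
      using fin Y le by (intro sum_strict_mono_ex1) auto
    then show False using eq count by (simp add: mult.commute)
  qed
  then have "?below Y = nsets Y s" using below[OF Y] by (intro card_subset_eq) auto
  then show "nsets Y s \<subseteq> H" by blast
qed

text \<open>New sets have size s + 1 \<le> k, so differences taken from them are at most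
  \<open>k\<close> for free. In the other direction, passing from a member to a superset only
  shrinks the difference.\<close>

lemma differencing_raise_level:
  assumes "finite V" "F \<subseteq> Pow V" "differencing k F" "\<And>A. A \<in> F \<Longrightarrow> s \<le> card A" "s < k"
  defines "U \<equiv> upper_shadow V s (F \<inter> nsets V s)"
  shows "differencing k ((F - nsets V s) \<union> U)" and "F \<inter> U = {}"
proof -
  have below: "\<exists>A\<in>F. A \<subset> Y \<and> card A = s" if Y: "Y \<in> U" for Y
  proof -
    obtain A where "A \<in> F" "A \<subseteq> Y" "card A = s" "card Y = Suc s"
      using Y by (auto simp: U_def upper_shadow_def nsets_def)
    then show ?thesis by (intro bexI[of _ A]) auto
  qed
  show disj: "F \<inter> U = {}"
    using below differencingD(2)[OF assms(3)] by blast
  have cross: "card (Y - B) \<in> {1..k} \<and> card (B - Y) \<in> {1..k}"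
    if Y: "Y \<in> U" and B: "B \<in> F - nsets V s" for Y B
  proof -
    obtain A where A: "A \<in> F" "A \<subset> Y" "card A = s" using below[OF Y] by blast
    have "finite C" if "C \<in> F" for C using assms(1,2) that finite_subset by blast
    then have fin: "finite A" "finite B" using A B by auto
    have "finite Y" using Y by (simp add: U_def upper_shadow_def nsets_def)
    note fin = fin this
    have card_Y: "card Y = Suc s" using Y by (simp add: U_def upper_shadow_def nsets_def)
    have "card B \<noteq> s" using B assms(2) fin by (auto simp: nsets_def)
    then have le: "card Y \<le> card B" using B assms(4)[of B] card_Y by auto
    have "A \<noteq> B" using \<open>card B \<noteq> s\<close> A by auto
    note AB = differencingD[OF assms(3), of A B] differencingD[OF assms(3), of B A]
    have "\<not> Y \<subseteq> B" using AB A B \<open>A \<noteq> B\<close> by blast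
    moreover from this have "\<not> B \<subseteq> Y" using le fin card_seteq[of Y B] by auto
    moreover have "card (Y - B) \<le> k"
      using card_mono[of Y "Y - B"] fin card_Y assms(5) by auto
    moreover have "card (B - Y) \<le> card (B - A)" using A fin by (intro card_mono) auto
    moreover have "card (B - A) \<le> k" using AB A B \<open>A \<noteq> B\<close> by blast
    ultimately show ?thesis using fin by (simp add: Suc_le_eq card_gt_0_iff)
  qed
  have level: "card (Y - Z) \<in> {1..k}" if YZ: "Y \<in> U" "Z \<in> U" "Y \<noteq> Z" for Y Z
  proof -
    have *: "finite Y" "finite Z" "card Y = Suc s" "card Z = Suc s"
      using YZ by (auto simp: U_def upper_shadow_def nsets_def)
    then have "\<not> Y \<subseteq> Z" using YZ card_subset_eq[of Z Y] by auto
    moreover have "card (Y - Z) \<le> k" using card_mono[of Y "Y - Z"] * assms(5) by auto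
    ultimately show ?thesis using * by (simp add: Suc_le_eq card_gt_0_iff)
  qed
  show "differencing k ((F - nsets V s) \<union> U)"
    using cross level assms(3) unfolding differencing_def by blast
qed

lemma card_raise_level:
  assumes "finite V" "F \<subseteq> Pow V" "differencing k F" "\<And>A. A \<in> F \<Longrightarrow> s \<le> card A" "s < k"
  defines "U \<equiv> upper_shadow V s (F \<inter> nsets V s)"
  shows "card ((F - nsets V s) \<union> U) + card (F \<inter> nsets V s) = card F + card U"
proof -
  have "finite F" using assms(1,2) by (simp add: finite_subset)
  moreover have "finite U"
    using assms(1) by (simp add: U_def upper_shadow_def finite_imp_finite_nsets)
  moreover have "(F - nsets V s) \<inter> U = {}"
    using differencing_raise_level(2)[OF assms(1-5)] U_def by blast
  ultimately show ?thesis
    using card_Int_Diff[of F "nsets V s"] by (simp add: card_Un_disjoint)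
qed

section \<open>The bound and the equality case for arbitrary sizes\<close>

text \<open>Induction on the number \<open>d\<close> of levels below \<open>k\<close> that may be
  occupied: each step empties the lowest one into its upper shadow.\<close>

lemma differencing_card_le:
  assumes "finite V" "2 * k - 1 \<le> card V" "F \<subseteq> Pow V" "differencing k F"
  shows "card F \<le> card V choose k"
proof -
  have "card F \<le> card V choose k"
    if "F \<subseteq> Pow V" "differencing k F" "\<And>A. A \<in> F \<Longrightarrow> k - d \<le> card A" for d F
    using that
  proof (induction d arbitrary: F)
    case 0
    then show ?case using differencing_card_le_of_large[OF assms(1)] by simp
  next
    case (Suc d)
    show ?case
    proof (cases "d < k")
      case False
      \<comment> \<open>For \<open>d \<ge> k\<close> both k - Suc d and k - d are truncated to 0, so
        the induction hypothesis applies unchanged.\<close>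
      then show ?thesis using Suc by simp
    next
      case True
      define s where "s = k - Suc d"
      have s: "s < k" "Suc s = k - d" using True by (simp_all add: s_def)
      define U where "U = upper_shadow V s (F \<inter> nsets V s)"
      have prem: "F \<subseteq> Pow V" "differencing k F" "\<And>A. A \<in> F \<Longrightarrow> s \<le> card A"
        using Suc.prems by (auto simp: s_def)
      have "card ((F - nsets V s) \<union> U) \<le> card V choose k"
      proof (rule Suc.IH)
        show "differencing k ((F - nsets V s) \<union> U)"
          unfolding U_def by (rule differencing_raise_level[OF assms(1) prem s(1)])
        show "(F - nsets V s) \<union> U \<subseteq> Pow V"
          using prem(1) by (auto simp: U_def upper_shadow_def nsets_def)
        fix A assume "A \<in> (F - nsets V s) \<union> U"
        then show "k - d \<le> card A"
        proof
          assume A: "A \<in> F - nsets V s"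
          then have "finite A" using prem(1) assms(1) finite_subset by blast
          then have "card A \<noteq> s" using A prem(1) by (auto simp: nsets_def)
          then show ?thesis using A prem(3)[of A] s by simp
        qed (use s in \<open>simp add: U_def upper_shadow_def nsets_def\<close>)
      qed
      \<comment> \<open>This is s + 1 \<le> card V - s, from 2 s + 1 \<le> 2 k - 1 \<le> card V;
        hence the shadow is at least as large as the level.\<close>
      moreover have "Suc s * card (F \<inter> nsets V s) \<le> (card V - s) * card (F \<inter> nsets V s)"
        using assms(2) s by (intro mult_le_mono1) simp
      then have "Suc s * card (F \<inter> nsets V s) \<le> Suc s * card U"
        unfolding U_def using upper_shadow_card(1)[OF assms(1), of "F \<inter> nsets V s" s]
        by (meson inf_le2 le_trans)
      then have "card (F \<inter> nsets V s) \<le> card U" by (simp only: mult_le_cancel1)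
      ultimately show ?thesis
        using card_raise_level[OF assms(1) prem s(1)] by (simp add: U_def)
    qed
  qed
  from this[of F k] show ?thesis using assms by simp
qed

text \<open>If some member is smaller than \<open>k\<close>, raising the lowest level cannot enlarge
  the extremal family, so the shadow count is tight. This forces card V = 2 k - 1 and lowest size k
  - 1, and the family is the full level card V - k.\<close>

lemma differencing_extremal:
  assumes "finite V" "2 * k - 1 \<le> card V" "1 \<le> k" "F \<subseteq> Pow V" "differencing k F"
    and card_F: "card F = card V choose k"
  shows "F = nsets V k \<or> F = nsets V (card V - k)"
proof (cases "\<forall>A\<in>F. k \<le> card A")
  case True
  then show ?thesis
    using differencing_extremal_of_large[OF assms(1,4,5) _ card_F assms(3)] by blast
next
  case False
  then obtain A0 where A0: "A0 \<in> F" "card A0 < k" by force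
  obtain B0 where B0: "B0 \<in> F" "\<And>A. A \<in> F \<Longrightarrow> card B0 \<le> card A"
    using A0(1) ex_has_least_nat[of "\<lambda>A. A \<in> F" A0 card] by blast
  define s where "s = card B0"
  have s: "s < k" using A0 B0(2) by (auto simp: s_def intro: le_less_trans)
  have fin: "finite A" if "A \<in> F" for A using assms(1,4) that finite_subset by blast
  define H where "H = F \<inter> nsets V s"
  define U where "U = upper_shadow V s H"
  have "B0 \<in> H" using B0 assms(4) fin by (auto simp: H_def s_def nsets_def)
  have "finite H" using assms(1) by (simp add: H_def finite_imp_finite_nsets)
  then have "0 < card H" using \<open>B0 \<in> H\<close> by (auto simp: card_gt_0_iff)
  have min: "\<And>A. A \<in> F \<Longrightarrow> s \<le> card A" using B0(2) s_def by simp
  have "card ((F - nsets V s) \<union> U) \<le> card F"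
    unfolding card_F U_def H_def
    using differencing_raise_level(1)[OF assms(1,4,5) min s] assms(1,2,4)
    by (intro differencing_card_le) (auto simp: upper_shadow_def nsets_def)
  then have "card U \<le> card H"
    using card_raise_level[OF assms(1,4,5) min s] by (simp add: U_def H_def)
  have shadow: "(card V - s) * card H \<le> Suc s * card U"
    unfolding U_def using assms(1) by (intro upper_shadow_card) (auto simp: H_def)
  also have upper: "\<dots> \<le> Suc s * card H" using \<open>card U \<le> card H\<close> by (rule mult_le_mono2)
  finally have "card V - s \<le> Suc s" using \<open>0 < card H\<close> by (simp only: mult_le_cancel2)
  then have sk: "Suc s = k" "card V = Suc (2 * s)" using s assms(2) by simp_all
  then have "(card V - s) * card H = Suc s * card U" using shadow upper by simp
  then have full: "nsets Y s \<subseteq> H" if "Y \<in> U" for Y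
    using upper_shadow_card(2)[OF assms(1), of H s Y] that by (simp add: U_def H_def)
  have "H = nsets V s"
  proof (rule swap_closed_eq_nsets[OF assms(1)])
    fix A i j assume A: "A \<in> H" and j: "j \<in> A" and i: "i \<in> V - A"
    have *: "finite A" "A \<subseteq> V" "card A = s" using A by (auto simp: H_def nsets_def)
    \<comment> \<open>A swap stays within the s-subsets of a shadow set, all of which belong to
      \<open>H\<close> by tightness.\<close>
    have "insert i A \<in> U" using A i * by (auto simp: U_def upper_shadow_def nsets_def)
    moreover have "insert i (A - {j}) \<in> nsets (insert i A) s"
      using * i j card_Suc_Diff1[of A j] by (auto simp: nsets_def card_insert_if)
    ultimately show "insert i (A - {j}) \<in> H" using full by blast
  qed (use \<open>B0 \<in> H\<close> in \<open>auto simp: H_def\<close>)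
  have "F = H"
  proof
    show "F \<subseteq> H"
    proof
      fix B assume B: "B \<in> F"
      \<comment> \<open>Any member contains an s-set, which is itself a member; as members are
        incomparable, the two coincide.\<close>
      obtain C where C: "C \<subseteq> B" "card C = s" "finite C"
        using min[OF B] obtain_subset_with_card_n by blast
      then have "C \<in> H" using \<open>H = nsets V s\<close> B assms(4) by (auto simp: nsets_def)
      then have "C = B" using differencingD(2)[OF assms(5) _ B, of C] C(1) by (auto simp: H_def)
      then show "B \<in> H" using \<open>C \<in> H\<close> by simp
    qed
  qed (simp add: H_def)
  moreover have "card V - k = s" using sk by simp
  ultimately show ?thesis using \<open>H = nsets V s\<close> by simp
qed

theorem theorem1p3:
  fixes k n :: nat and F :: "nat set set"
  assumes "k \<ge> 1" and "n \<ge> 2 * k - 1"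
    and "F \<subseteq> Pow {1..n}" and "differencing k F"
  shows "card F \<le> n choose k \<and>
    (card F = n choose k \<longleftrightarrow> F = nsets {1..n} k \<or> F = nsets {1..n} (n - k))"
proof -
  have "k \<le> n" using assms(1,2) by simp
  then have "card F = n choose k" if "F = nsets {1..n} k \<or> F = nsets {1..n} (n - k)"
    using that by (auto simp: card_nsets binomial_symmetric[of k n])
  moreover have "card F \<le> n choose k"
    using differencing_card_le[of "{1..n}" k F] assms by simp
  moreover have "F = nsets {1..n} k \<or> F = nsets {1..n} (n - k)" if "card F = n choose k"
    using differencing_extremal[of "{1..n}" k F] assms that by simp
  ultimately show ?thesis by blast
qed

end
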